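(* The diffeological realization functor $|-|_D:\mathrm{sSet}\to\mathrm{Diff}$ does not commute with finite products; that is, it is not the case that for all simplicial sets $X$ and $Y$ the natural map $|X\times Y|_D\to|X|_D\times|Y|_D$ induced by the projections is a diffeomorphism.
   Context: A diffeological space is a set $X$ together with, for each $n\in\mathbb{N}$ and each open $U\subseteq\mathbb{R}^n$, a specified set of functions $U\to X$ called plots, such that: every constant map is a plot; if $U\to X$ is a plot and $V\to U$ is a smooth map between open subsets of Euclidean spaces then the composite $V\to X$ is a plot; and a function $U\to X$ whose restriction to each member of some open cover of $U$ is a plot is itself a plot. A map $f:X\to Y$ is smooth if $f\circ p$ is a plot of $Y$ for every plot $p$ of $X$. $\mathrm{Diff}$ is the (complete and cocomplete) category of diffeological spaces and smooth maps, whose isomorphisms are called diffeomorphisms; $\mathrm{sSet}$ is the category of simplicial sets. $\mathbb{R}^n$ has as plots the usual smooth maps; products have plots with both components plots. A subset $A\subseteq X$ has the sub-diffeology: $U\to A$ is a plot iff $U\to A\hookrightarrow X$ is. Let $\mathbb{A}^n=\{(x_0,\dots,x_n)\in\mathbb{R}^{n+1}\mid\sum x_i=1\}$ with the sub-diffeology from $\mathbb{R}^{n+1}$. A map $f:\{0,\dots,n\}\to\{0,\dots,m\}$ in the simplicial category induces $f_*:\mathbb{A}^n\to\mathbb{A}^m$, $f_*(x)_j=\sum_{i\in f^{-1}(j)}x_i$, so $\mathbb{A}^\bullet$ is a cosimplicial object in $\mathrm{Diff}$. The diffeological realization of a simplicial set $A$ is $|A|_D=\operatorname{colim}_{\Delta^n\to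 A}\mathbb{A}^n$, the colimit in $\mathrm{Diff}$ over the category of simplices of $A$. It is left adjoint to the functor $S^D$ with $S^D_n(X)$ the set of smooth maps $\mathbb{A}^n\to X$. *)

theory Defs
  imports "HOL-Analysis.Analysis"
begin

section \<open>Smooth maps between open subsets of Euclidean spaces\<close>

text \<open>
  The plots of a diffeology have domains in all dimensions at once, so \<open>\<real>\<^sup>n\<close> is taken to be
  \<^const>\<open>Euclidean_space\<close> \<open>n\<close>, whose points are the functions \<open>nat \<Rightarrow> real\<close> vanishing from index
  \<open>n\<close> on.  A map on a subset \<open>U\<close> of it is a total HOL function of which only the values on \<open>U\<close>
  matter.

  \<open>Ck_on k n U f\<close>: on the open set \<open>U \<subseteq> \<real>\<^sup>n\<close> all iterated partial derivatives of \<open>f\<close> of order at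
  most \<open>k\<close> exist and are continuous.
\<close>

primrec Ck_on :: "nat \<Rightarrow> nat \<Rightarrow> (nat \<Rightarrow> real) set \<Rightarrow> ((nat \<Rightarrow> real) \<Rightarrow> real) \<Rightarrow> bool" where
  "Ck_on 0 n U f \<longleftrightarrow> continuous_on U f"
| "Ck_on (Suc k) n U f \<longleftrightarrow> continuous_on U f \<and>
     (\<forall>i<n. \<exists>g. (\<forall>x\<in>U. ((\<lambda>t. f (x(i := t))) has_real_derivative g x) (at (x i))) \<and> Ck_on k n U g)"

definition smooth_map ::
  "nat \<Rightarrow> (nat \<Rightarrow> real) set \<Rightarrow> nat \<Rightarrow> (nat \<Rightarrow> real) set \<Rightarrow> ((nat \<Rightarrow> real) \<Rightarrow> (nat \<Rightarrow> real)) \<Rightarrow> bool"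
  where "smooth_map m V n U f \<longleftrightarrow>
    openin (Euclidean_space m) V \<and> openin (Euclidean_space n) U \<and> f \<in> V \<rightarrow> U \<and>
    (\<forall>j<n. \<forall>k. Ck_on k m V (\<lambda>x. f x j))"


section \<open>Diffeological spaces\<close>

text \<open>\<open>plot X n U p\<close>: \<open>p\<close> is a plot of \<open>X\<close> with domain the open set \<open>U \<subseteq> \<real>\<^sup>n\<close>.\<close>

record 'a diff_space =
  points :: "'a set"
  plot :: "nat \<Rightarrow> (nat \<Rightarrow> real) set \<Rightarrow> ((nat \<Rightarrow> real) \<Rightarrow> 'a) \<Rightarrow> bool"

text \<open>The congruence axiom expresses that a plot is a function on \<open>U\<close>, i.e. that its values outside
  \<open>U\<close> are irrelevant.\<close>

locale diffeological_space =
  fixes X :: "'a diff_space"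
  assumes plot_domain: "plot X n U p \<Longrightarrow> openin (Euclidean_space n) U"
    and plot_maps: "plot X n U p \<Longrightarrow> p \<in> U \<rightarrow> points X"
    and plot_cong: "plot X n U p \<Longrightarrow> (\<And>u. u \<in> U \<Longrightarrow> q u = p u) \<Longrightarrow> plot X n U q"
    and plot_const: "openin (Euclidean_space n) U \<Longrightarrow> x \<in> points X \<Longrightarrow> plot X n U (\<lambda>_. x)"
    and plot_comp: "plot X n U p \<Longrightarrow> smooth_map m V n U f \<Longrightarrow> plot X m V (p \<circ> f)"
    and plot_local: "(\<And>V. V \<in> \<V> \<Longrightarrow> openin (Euclidean_space n) V \<and> plot X n V p) \<Longrightarrow> plot X n (\<Union>\<V>) p"

definition smooth_between :: "'a diff_space \<Rightarrow> 'b diff_space \<Rightarrow> ('a \<Rightarrow> 'b) \<Rightarrow> bool" where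
  "smooth_between X Y f \<longleftrightarrow> f \<in> points X \<rightarrow> points Y \<and>
     (\<forall>n U p. plot X n U p \<longrightarrow> plot Y n U (f \<circ> p))"

definition diffeomorphism :: "'a diff_space \<Rightarrow> 'b diff_space \<Rightarrow> ('a \<Rightarrow> 'b) \<Rightarrow> bool" where
  "diffeomorphism X Y f \<longleftrightarrow> smooth_between X Y f \<and>
     (\<exists>g. smooth_between Y X g \<and> (\<forall>x\<in>points X. g (f x) = x) \<and> (\<forall>y\<in>points Y. f (g y) = y))"

definition diff_Euclidean :: "nat \<Rightarrow> (nat \<Rightarrow> real) diff_space" where
  "diff_Euclidean n = \<lparr>points = topspace (Euclidean_space n),
     plot = (\<lambda>m U p. smooth_map m U n (topspace (Euclidean_space n)) p)\<rparr>"

definition diff_sub :: "'a diff_space \<Rightarrow> 'a set \<Rightarrow> 'a diff_space" where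
  "diff_sub X A = \<lparr>points = A, plot = (\<lambda>n U p. p \<in> U \<rightarrow> A \<and> plot X n U p)\<rparr>"

definition diff_prod :: "'a diff_space \<Rightarrow> 'b diff_space \<Rightarrow> ('a \<times> 'b) diff_space" where
  "diff_prod X Y = \<lparr>points = points X \<times> points Y,
     plot = (\<lambda>n U p. plot X n U (fst \<circ> p) \<and> plot Y n U (snd \<circ> p))\<rparr>"


section \<open>Colimits of diffeological spaces\<close>

text \<open>
  A diagram is given by a set \<open>J\<close> of objects, a space \<open>D j\<close> for each \<open>j \<in> J\<close>, and a set \<open>M\<close> of
  triples \<open>(j, k, h)\<close>, one for each arrow \<open>j \<rightarrow> k\<close> of the indexing category, with \<open>h\<close> the map
  \<open>D j \<rightarrow> D k\<close> assigned to it.  The colimit is the quotient of the disjoint union of the \<open>D j\<close> by the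
  equivalence relation generated by \<open>(j, x) \<sim> (k, h x)\<close>; its plots are the maps that locally lift
  to a plot of one of the \<open>D j\<close>.  The lemmas below show that this is a colimit in the category of
  diffeological spaces.
\<close>

definition colim_gen ::
  "('j \<Rightarrow> 'a diff_space) \<Rightarrow> ('j \<times> 'j \<times> ('a \<Rightarrow> 'a)) set \<Rightarrow> (('j \<times> 'a) \<times> ('j \<times> 'a)) set" where
  "colim_gen D M = {((j, x), (k, h x)) | j k h x. (j, k, h) \<in> M \<and> x \<in> points (D j)}"

definition colim_rel ::
  "'j set \<Rightarrow> ('j \<Rightarrow> 'a diff_space) \<Rightarrow> ('j \<times> 'j \<times> ('a \<Rightarrow> 'a)) set \<Rightarrow> (('j \<times> 'a) \<times> ('j \<times> 'a)) set" where
  "colim_rel J D M =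
     (colim_gen D M \<union> (colim_gen D M)\<inverse>)\<^sup>* \<inter> (SIGMA j:J. points (D j)) \<times> (SIGMA j:J. points (D j))"

definition colim_inj ::
  "'j set \<Rightarrow> ('j \<Rightarrow> 'a diff_space) \<Rightarrow> ('j \<times> 'j \<times> ('a \<Rightarrow> 'a)) set \<Rightarrow> 'j \<Rightarrow> 'a \<Rightarrow> ('j \<times> 'a) set" where
  "colim_inj J D M j x = colim_rel J D M `` {(j, x)}"

definition diff_colim ::
  "'j set \<Rightarrow> ('j \<Rightarrow> 'a diff_space) \<Rightarrow> ('j \<times> 'j \<times> ('a \<Rightarrow> 'a)) set \<Rightarrow> ('j \<times> 'a) set diff_space" where
  "diff_colim J D M =
     \<lparr>points = (SIGMA j:J. points (D j)) // colim_rel J D M,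
      plot = (\<lambda>n U p. openin (Euclidean_space n) U \<and>
        (\<forall>u\<in>U. \<exists>V j q. openin (Euclidean_space n) V \<and> u \<in> V \<and> V \<subseteq> U \<and> j \<in> J \<and>
           plot (D j) n V q \<and> (\<forall>v\<in>V. p v = colim_inj J D M j (q v))))\<rparr>"

text \<open>The map out of the colimit induced by a cocone \<open>g\<close>, i.e. by maps \<open>g j\<close> from \<open>D j\<close> that are
  compatible with the arrows: these take a single value on each equivalence class.\<close>

definition colim_desc :: "('j \<Rightarrow> 'a \<Rightarrow> 'b) \<Rightarrow> ('j \<times> 'a) set \<Rightarrow> 'b" where
  "colim_desc g c = the_elem ((\<lambda>(j, x). g j x) ` c)"

lemma Ck_on_subset: "Ck_on k n U f \<Longrightarrow> V \<subseteq> U \<Longrightarrow> Ck_on k n V f"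
proof (induction k arbitrary: f)
  case 0
  then show ?case by (simp add: continuous_on_subset)
next
  case (Suc k)
  show ?case
    unfolding Ck_on.simps
  proof (intro conjI allI impI)
    show "continuous_on V f" using Suc.prems continuous_on_subset by auto
  next
    fix i assume "i < n"
    then obtain g where "\<forall>x\<in>U. ((\<lambda>t. f (x(i := t))) has_real_derivative g x) (at (x i))"
      and "Ck_on k n U g"
      using Suc.prems by auto
    then show "\<exists>g. (\<forall>x\<in>V. ((\<lambda>t. f (x(i := t))) has_real_derivative g x) (at (x i))) \<and> Ck_on k n V g"
      using Suc.IH Suc.prems(2) by blast
  qed
qed

lemma smooth_map_preimage:
  assumes f: "smooth_map m V n U f" and W: "openin (Euclidean_space n) W"
  shows "openin (Euclidean_space m) {v \<in> V. f v \<in> W}"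
proof -
  have V: "openin (Euclidean_space m) V" and U: "openin (Euclidean_space n) U"
    and maps: "f \<in> V \<rightarrow> U" and C: "\<And>j. j < n \<Longrightarrow> Ck_on 0 m V (\<lambda>x. f x j)"
    using f unfolding smooth_map_def by blast+
  have sub: "U \<subseteq> topspace (Euclidean_space n)" "V \<subseteq> topspace (Euclidean_space m)"
    using U V openin_subset by auto
  have "continuous_on V (\<lambda>x. f x j)" for j
  proof (cases "j < n")
    case True
    then show ?thesis using C[of j] by simp
  next
    case False
    then have "f x j = 0" if "x \<in> V" for x
      using that maps sub(1) by (auto simp: topspace_Euclidean_space Pi_iff subset_iff)
    then show ?thesis by simp
  qed
  then have "continuous_on V f"
    by (rule continuous_on_coordinatewise_then_product)
  then have "continuous_map (subtopology (Euclidean_space m) V) (Euclidean_space n) f"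
    using maps sub by (auto simp: cm_Euclidean_space_iff_continuous_on topspace_subtopology Int_absorb1)
  then have "openin (subtopology (Euclidean_space m) V) {v \<in> topspace (subtopology (Euclidean_space m) V). f v \<in> W}"
    using W by (rule openin_continuous_map_preimage)
  moreover have "topspace (subtopology (Euclidean_space m) V) = V"
    using sub by auto
  ultimately have "openin (subtopology (Euclidean_space m) V) {v \<in> V. f v \<in> W}"
    by (simp only:)
  then show ?thesis
    using V by (simp add: openin_open_subtopology)
qed

locale diff_diagram =
  fixes J :: "'j set" and D :: "'j \<Rightarrow> 'a diff_space" and M :: "('j \<times> 'j \<times> ('a \<Rightarrow> 'a)) set"
  assumes space: "j \<in> J \<Longrightarrow> diffeological_space (D j)"
    and arrow: "(j, k, h) \<in> M \<Longrightarrow> j \<in> J \<and> k \<in> J \<and> smooth_between (D j) (D k) h"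
begin

lemma equiv_colim_rel: "equiv (SIGMA j:J. points (D j)) (colim_rel J D M)"
proof -
  have "sym ((colim_gen D M \<union> (colim_gen D M)\<inverse>)\<^sup>*)"
    by (intro sym_rtrancl sym_Un_converse)
  then show ?thesis
    unfolding equiv_def colim_rel_def
    by (auto simp: refl_on_def sym_def intro!: transI)
qed

lemma colim_inj_maps: "j \<in> J \<Longrightarrow> x \<in> points (D j) \<Longrightarrow> colim_inj J D M j x \<in> points (diff_colim J D M)"
  unfolding diff_colim_def colim_inj_def by (auto intro!: quotientI)

lemma colim_points_cases:
  assumes "c \<in> points (diff_colim J D M)"
  obtains j x where "j \<in> J" "x \<in> points (D j)" "c = colim_inj J D M j x"
  using assms unfolding diff_colim_def colim_inj_def by (auto elim!: quotientE)

text \<open>The injections form a cocone.\<close>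

lemma colim_inj_arrow:
  assumes "(j, k, h) \<in> M" "x \<in> points (D j)"
  shows "colim_inj J D M k (h x) = colim_inj J D M j x"
proof -
  have "h x \<in> points (D k)" "j \<in> J" "k \<in> J"
    using arrow[OF assms(1)] assms(2) by (auto simp: smooth_between_def)
  moreover have "((j, x), (k, h x)) \<in> colim_gen D M"
    using assms by (auto simp: colim_gen_def)
  ultimately have "((j, x), (k, h x)) \<in> colim_rel J D M"
    using assms by (auto simp: colim_rel_def)
  then show ?thesis
    unfolding colim_inj_def by (metis equiv_class_eq[OF equiv_colim_rel])
qed

lemma plot_colimI:
  assumes "openin (Euclidean_space n) U"
    and "\<And>u. u \<in> U \<Longrightarrow> \<exists>V j q. openin (Euclidean_space n) V \<and> u \<in> V \<and> V \<subseteq> U \<and> j \<in> J \<and>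
           plot (D j) n V q \<and> (\<forall>v\<in>V. p v = colim_inj J D M j (q v))"
  shows "plot (diff_colim J D M) n U p"
  using assms by (simp add: diff_colim_def)

lemma plot_colimE:
  assumes "plot (diff_colim J D M) n U p" "u \<in> U"
  obtains V j q where "openin (Euclidean_space n) V" "u \<in> V" "V \<subseteq> U" "j \<in> J"
    "plot (D j) n V q" "\<forall>v\<in>V. p v = colim_inj J D M j (q v)"
proof -
  have "\<forall>u\<in>U. \<exists>V j q. openin (Euclidean_space n) V \<and> u \<in> V \<and> V \<subseteq> U \<and> j \<in> J \<and>
           plot (D j) n V q \<and> (\<forall>v\<in>V. p v = colim_inj J D M j (q v))"
    using assms(1) by (simp add: diff_colim_def)
  from bspec[OF this assms(2)] show ?thesis using that by blast
qed

lemma diffeological_space_colim: "diffeological_space (diff_colim J D M)"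
proof
  fix n U p assume p: "plot (diff_colim J D M) n U p"
  then show "openin (Euclidean_space n) U" by (simp add: diff_colim_def)
  show "p \<in> U \<rightarrow> points (diff_colim J D M)"
  proof
    fix u assume "u \<in> U"
    with p obtain V j q where V: "openin (Euclidean_space n) V" "u \<in> V" "V \<subseteq> U" "j \<in> J"
       "plot (D j) n V q" "\<forall>v\<in>V. p v = colim_inj J D M j (q v)"
      by (rule plot_colimE)
    have "q u \<in> points (D j)"
      using diffeological_space.plot_maps[OF space[OF V(4)] V(5)] V(2) by auto
    then show "p u \<in> points (diff_colim J D M)"
      using V by (simp add: colim_inj_maps)
  qed
next
  fix n U p q
  assume p: "plot (diff_colim J D M) n U p" and q: "\<And>u. u \<in> U \<Longrightarrow> q u = p u"
  show "plot (diff_colim J D M) n U q"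
  proof (rule plot_colimI)
    show "openin (Euclidean_space n) U" using p by (simp add: diff_colim_def)
    fix u assume "u \<in> U"
    with p obtain V j r where V: "openin (Euclidean_space n) V" "u \<in> V" "V \<subseteq> U" "j \<in> J"
       "plot (D j) n V r" "\<forall>v\<in>V. p v = colim_inj J D M j (r v)"
      by (rule plot_colimE)
    then have "\<forall>v\<in>V. q v = colim_inj J D M j (r v)"
      using q by (simp add: subset_iff)
    then show "\<exists>V j r. openin (Euclidean_space n) V \<and> u \<in> V \<and> V \<subseteq> U \<and> j \<in> J \<and>
           plot (D j) n V r \<and> (\<forall>v\<in>V. q v = colim_inj J D M j (r v))"
      using V(1-5) by blast
  qed
next
  fix n U x assume U: "openin (Euclidean_space n) U" and x: "x \<in> points (diff_colim J D M)"
  obtain j y where *: "j \<in> J" "y \<in> points (D j)" "x = colim_inj J D M j y"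
    using x by (rule colim_points_cases)
  have "plot (D j) n U (\<lambda>_. y)"
    by (rule diffeological_space.plot_const[OF space[OF *(1)] U *(2)])
  then show "plot (diff_colim J D M) n U (\<lambda>_. x)"
    using U *(1,3) by (intro plot_colimI) blast+
next
  fix n U p m V f
  assume p: "plot (diff_colim J D M) n U p" and f: "smooth_map m V n U f"
  have "\<exists>V' j q. openin (Euclidean_space m) V' \<and> v \<in> V' \<and> V' \<subseteq> V \<and> j \<in> J \<and>
           plot (D j) m V' q \<and> (\<forall>v\<in>V'. (p \<circ> f) v = colim_inj J D M j (q v))" if v: "v \<in> V" for v
  proof -
    have "f v \<in> U" using f v by (auto simp: smooth_map_def)
    with p obtain W j q where W: "openin (Euclidean_space n) W" "f v \<in> W" "W \<subseteq> U" "j \<in> J"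
       "plot (D j) n W q" "\<forall>w\<in>W. p w = colim_inj J D M j (q w)"
      by (rule plot_colimE)
    let ?V = "{v \<in> V. f v \<in> W}"
    have o: "openin (Euclidean_space m) ?V"
      using smooth_map_preimage[OF f W(1)] .
    have "smooth_map m ?V n W f"
      using f W(1) o unfolding smooth_map_def by (auto intro: Ck_on_subset)
    then have "plot (D j) m ?V (q \<circ> f)"
      by (rule diffeological_space.plot_comp[OF space[OF W(4)] W(5)])
    then show ?thesis
      using o W(2,4,6) v by (intro exI[of _ ?V] exI[of _ j] exI[of _ "q \<circ> f"] conjI) auto
  qed
  note loc = this
  have "openin (Euclidean_space m) V" using f by (simp add: smooth_map_def)
  then show "plot (diff_colim J D M) m V (p \<circ> f)"
    using loc by (rule plot_colimI)
next
  fix \<V> n p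
  assume *: "\<And>V. V \<in> \<V> \<Longrightarrow> openin (Euclidean_space n) V \<and> plot (diff_colim J D M) n V p"
  have "\<exists>V j q. openin (Euclidean_space n) V \<and> u \<in> V \<and> V \<subseteq> \<Union>\<V> \<and> j \<in> J \<and>
           plot (D j) n V q \<and> (\<forall>v\<in>V. p v = colim_inj J D M j (q v))" if u: "u \<in> \<Union>\<V>" for u
  proof -
    obtain W where W: "W \<in> \<V>" "u \<in> W" using u by auto
    obtain V j q where "openin (Euclidean_space n) V" "u \<in> V" "V \<subseteq> W" "j \<in> J"
           "plot (D j) n V q" "\<forall>v\<in>V. p v = colim_inj J D M j (q v)"
      using *[OF W(1), THEN conjunct2] W(2) by (rule plot_colimE)
    moreover have "W \<subseteq> \<Union>\<V>" using W(1) by blast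
    ultimately show ?thesis by blast
  qed
  note loc = this
  have "openin (Euclidean_space n) (\<Union>\<V>)"
    by (rule openin_Union) (use * in blast)
  then show "plot (diff_colim J D M) n (\<Union>\<V>) p"
    using loc by (rule plot_colimI)
qed

lemma smooth_colim_inj:
  assumes j: "j \<in> J"
  shows "smooth_between (D j) (diff_colim J D M) (colim_inj J D M j)"
proof -
  have "plot (diff_colim J D M) n U (colim_inj J D M j \<circ> p)" if "plot (D j) n U p" for n U p
    using diffeological_space.plot_domain[OF space[OF j] that]
  proof (rule plot_colimI)
    fix u assume "u \<in> U"
    moreover have "\<forall>v\<in>U. (colim_inj J D M j \<circ> p) v = colim_inj J D M j (p v)"
      by simp
    ultimately show "\<exists>V k q. openin (Euclidean_space n) V \<and> u \<in> V \<and> V \<subseteq> U \<and> k \<in> J \<and>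
        plot (D k) n V q \<and> (\<forall>v\<in>V. (colim_inj J D M j \<circ> p) v = colim_inj J D M k (q v))"
      using that j diffeological_space.plot_domain[OF space[OF j] that] by blast
  qed
  then show ?thesis
    using j by (auto simp: smooth_between_def colim_inj_maps)
qed

lemma colim_desc_inj:
  assumes compat: "\<And>j k h x. (j, k, h) \<in> M \<Longrightarrow> x \<in> points (D j) \<Longrightarrow> g k (h x) = g j x"
    and j: "j \<in> J" and x: "x \<in> points (D j)"
  shows "colim_desc g (colim_inj J D M j x) = g j x"
proof -
  have "(\<lambda>(j, x). g j x) b = (\<lambda>(j, x). g j x) a"
    if "(a, b) \<in> (colim_gen D M \<union> (colim_gen D M)\<inverse>)\<^sup>*" for a b
    using that by (induction rule: rtrancl_induct) (auto simp: colim_gen_def compat)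
  then have "(\<lambda>(j, x). g j x) ` colim_inj J D M j x \<subseteq> {g j x}"
    by (fastforce simp: colim_inj_def colim_rel_def)
  moreover have "(j, x) \<in> colim_inj J D M j x"
    using j x by (auto simp: colim_inj_def colim_rel_def)
  ultimately have "(\<lambda>(j, x). g j x) ` colim_inj J D M j x = {g j x}"
    by force
  then show ?thesis by (simp add: colim_desc_def)
qed

text \<open>Every smooth cocone factors through the colimit, by a unique smooth map.\<close>

theorem colim_desc_smooth:
  assumes Y: "diffeological_space Y" and g: "\<And>j. j \<in> J \<Longrightarrow> smooth_between (D j) Y (g j)"
    and compat: "\<And>j k h x. (j, k, h) \<in> M \<Longrightarrow> x \<in> points (D j) \<Longrightarrow> g k (h x) = g j x"
  shows "smooth_between (diff_colim J D M) Y (colim_desc g)"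
  unfolding smooth_between_def
proof (intro conjI allI impI)
  have desc: "colim_desc g (colim_inj J D M j x) = g j x" if "j \<in> J" "x \<in> points (D j)" for j x
    using compat that by (rule colim_desc_inj)
  show "colim_desc g \<in> points (diff_colim J D M) \<rightarrow> points Y"
  proof
    fix c assume "c \<in> points (diff_colim J D M)"
    then obtain j x where "j \<in> J" "x \<in> points (D j)" "c = colim_inj J D M j x"
      by (rule colim_points_cases)
    then show "colim_desc g c \<in> points Y"
      using g[of j] desc by (auto simp: smooth_between_def)
  qed
  fix n U p assume p: "plot (diff_colim J D M) n U p"
  define \<V> where "\<V> = {V. openin (Euclidean_space n) V \<and> V \<subseteq> U \<and> plot Y n V (colim_desc g \<circ> p)}"
  have "\<exists>V\<in>\<V>. u \<in> V" if u: "u \<in> U" for u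
  proof -
    obtain V j q where V: "openin (Euclidean_space n) V" "u \<in> V" "V \<subseteq> U" "j \<in> J"
           "plot (D j) n V q" "\<forall>v\<in>V. p v = colim_inj J D M j (q v)"
      using p u by (rule plot_colimE)
    have "plot Y n V (g j \<circ> q)"
      using g[OF V(4)] V(5) by (auto simp: smooth_between_def)
    moreover have "(colim_desc g \<circ> p) v = (g j \<circ> q) v" if v: "v \<in> V" for v
    proof -
      have "q v \<in> points (D j)"
        using diffeological_space.plot_maps[OF space[OF V(4)] V(5)] v by auto
      then show ?thesis using v V by (simp add: desc)
    qed
    ultimately have "plot Y n V (colim_desc g \<circ> p)"
      using diffeological_space.plot_cong[OF Y] by blast
    then show ?thesis using V by (auto simp: \<V>_def)
  qed
  then have "\<Union>\<V> = U" unfolding \<V>_def by blast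
  moreover have "plot Y n (\<Union>\<V>) (colim_desc g \<circ> p)"
    by (rule diffeological_space.plot_local[OF Y]) (simp add: \<V>_def)
  ultimately show "plot Y n U (colim_desc g \<circ> p)" by simp
qed

theorem colim_desc_unique:
  assumes compat: "\<And>j k h x. (j, k, h) \<in> M \<Longrightarrow> x \<in> points (D j) \<Longrightarrow> g k (h x) = g j x"
    and f: "\<And>j x. j \<in> J \<Longrightarrow> x \<in> points (D j) \<Longrightarrow> f (colim_inj J D M j x) = g j x"
    and c: "c \<in> points (diff_colim J D M)"
  shows "f c = colim_desc g c"
proof -
  obtain j x where *: "j \<in> J" "x \<in> points (D j)" "c = colim_inj J D M j x"
    using c by (rule colim_points_cases)
  moreover have "colim_desc g (colim_inj J D M j x) = g j x"
    using compat *(1,2) by (rule colim_desc_inj)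
  ultimately show ?thesis by (simp add: f)
qed

end


section \<open>Simplicial sets\<close>

text \<open>The morphisms \<open>[n] \<rightarrow> [m]\<close> of the simplicial category; taking them extensional makes equality
  of morphisms equality of HOL functions.\<close>

definition simplex_hom :: "nat \<Rightarrow> nat \<Rightarrow> (nat \<Rightarrow> nat) set" where
  "simplex_hom n m = {f \<in> {..n} \<rightarrow>\<^sub>E {..m}. mono_on {..n} f}"

text \<open>\<open>act X n m f\<close> is the map \<open>X\<^sub>m \<rightarrow> X\<^sub>n\<close> induced by \<open>f : [n] \<rightarrow> [m]\<close>.\<close>

record 'a sset =
  simplices :: "nat \<Rightarrow> 'a set"
  act :: "nat \<Rightarrow> nat \<Rightarrow> (nat \<Rightarrow> nat) \<Rightarrow> 'a \<Rightarrow> 'a"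

locale simplicial_set =
  fixes X :: "'a sset"
  assumes act_maps: "f \<in> simplex_hom n m \<Longrightarrow> x \<in> simplices X m \<Longrightarrow> act X n m f x \<in> simplices X n"
    and act_id: "x \<in> simplices X n \<Longrightarrow> act X n n (restrict id {..n}) x = x"
    and act_comp: "f \<in> simplex_hom n m \<Longrightarrow> g \<in> simplex_hom m l \<Longrightarrow> x \<in> simplices X l \<Longrightarrow>
      act X n l (compose {..n} g f) x = act X n m f (act X m l g x)"

definition sset_prod :: "'a sset \<Rightarrow> 'b sset \<Rightarrow> ('a \<times> 'b) sset" where
  "sset_prod X Y = \<lparr>simplices = (\<lambda>n. simplices X n \<times> simplices Y n),
     act = (\<lambda>n m f. map_prod (act X n m f) (act Y n m f))\<rparr>"


section \<open>Diffeological realization\<close>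

definition affine_simplex :: "nat \<Rightarrow> (nat \<Rightarrow> real) diff_space" where
  "affine_simplex n =
     diff_sub (diff_Euclidean (Suc n)) {x \<in> topspace (Euclidean_space (Suc n)). (\<Sum>i\<le>n. x i) = 1}"

definition affine_push :: "nat \<Rightarrow> (nat \<Rightarrow> nat) \<Rightarrow> (nat \<Rightarrow> real) \<Rightarrow> (nat \<Rightarrow> real)" where
  "affine_push n f x = (\<lambda>j. \<Sum>i\<in>{i. i \<le> n \<and> f i = j}. x i)"

text \<open>The objects of the category of simplices are the pairs \<open>(n, a)\<close> with \<open>a\<close> an \<open>n\<close>-simplex; its
  arrows \<open>(n, a) \<rightarrow> (m, b)\<close> are the \<open>f : [n] \<rightarrow> [m]\<close> with \<open>f\<^sup>* b = a\<close>.\<close>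

definition simplex_objects :: "'a sset \<Rightarrow> (nat \<times> 'a) set" where
  "simplex_objects A = (SIGMA n:UNIV. simplices A n)"

definition simplex_arrows ::
  "'a sset \<Rightarrow> ((nat \<times> 'a) \<times> (nat \<times> 'a) \<times> ((nat \<Rightarrow> real) \<Rightarrow> (nat \<Rightarrow> real))) set" where
  "simplex_arrows A =
     {((n, act A n m f b), (m, b), affine_push n f) | n m f b. f \<in> simplex_hom n m \<and> b \<in> simplices A m}"

definition realization :: "'a sset \<Rightarrow> ((nat \<times> 'a) \<times> (nat \<Rightarrow> real)) set diff_space" where
  "realization A = diff_colim (simplex_objects A) (affine_simplex \<circ> fst) (simplex_arrows A)"

definition realization_inj ::
  "'a sset \<Rightarrow> nat \<times> 'a \<Rightarrow> (nat \<Rightarrow> real) \<Rightarrow> ((nat \<times> 'a) \<times> (nat \<Rightarrow> real)) set" where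
  "realization_inj A = colim_inj (simplex_objects A) (affine_simplex \<circ> fst) (simplex_arrows A)"

text \<open>The map \<open>|A|\<^sub>D \<rightarrow> |B|\<^sub>D\<close> induced by the simplicial map with components \<open>h n : A\<^sub>n \<rightarrow> B\<^sub>n\<close>.\<close>

definition realization_map ::
  "'b sset \<Rightarrow> (nat \<Rightarrow> 'a \<Rightarrow> 'b) \<Rightarrow> ((nat \<times> 'a) \<times> (nat \<Rightarrow> real)) set \<Rightarrow> ((nat \<times> 'b) \<times> (nat \<Rightarrow> real)) set"
  where "realization_map B h = colim_desc (\<lambda>(n, a). realization_inj B (n, h n a))"

text \<open>The natural map \<open>|X \<times> Y|\<^sub>D \<rightarrow> |X|\<^sub>D \<times> |Y|\<^sub>D\<close>.\<close>

definition realization_comparison ::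
  "'a sset \<Rightarrow> 'b sset \<Rightarrow> ((nat \<times> 'a \<times> 'b) \<times> (nat \<Rightarrow> real)) set \<Rightarrow>
     ((nat \<times> 'a) \<times> (nat \<Rightarrow> real)) set \<times> ((nat \<times> 'b) \<times> (nat \<Rightarrow> real)) set" where
  "realization_comparison X Y c =
     (realization_map X (\<lambda>n. fst) c, realization_map Y (\<lambda>n. snd) c)"

end

theory Submission
  imports Defs
begin

text \<open>
  The comparison map fails to be injective already for \<open>X = Y = \<Delta>\<^sup>1\<close>.  The simplicial set
  \<open>\<Delta>\<^sup>1 \<times> \<Delta>\<^sup>1\<close> has two nondegenerate 2-simplices, the chains \<open>\<sigma> = (00 < 01 < 11)\<close> and
  \<open>\<tau> = (00 < 10 < 11)\<close>.  Since \<open>\<bbbA>\<^sup>2\<close> is a whole plane and not a triangle, each of them is mapped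
  bijectively onto the plane \<open>|\<Delta>\<^sup>1|\<^sub>D \<times> |\<Delta>\<^sup>1|\<^sub>D = \<bbbA>\<^sup>1 \<times> \<bbbA>\<^sup>1\<close>, so every point of that plane has a
  preimage in both.  In the realization of the product, however, the two planes are glued along
  the line of the common edge \<open>00 < 11\<close> only.  Concretely, the vertex \<open>01\<close>, which is the point
  \<open>(0, 1, 0)\<close> of \<open>\<sigma>\<close>, has the same image as the point \<open>(1, -1, 1)\<close> of \<open>\<tau>\<close>.

  That these two points are different in \<open>|\<Delta>\<^sup>1 \<times> \<Delta>\<^sup>1|\<^sub>D\<close> is seen from the total barycentric
  coordinate at the vertex \<open>01\<close>: on the copy of \<open>\<bbbA>\<^sup>n\<close> belonging to a simplex
  \<open>a : [n] \<rightarrow> [1] \<times> [1]\<close> it is the sum of the \<open>x\<^sub>i\<close> with \<open>a i = 01\<close>, which is compatible with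
  the simplicial operators (\<open>sum_affine_push\<close>) and so defines a function on the realization.  It is
  1 at the first point and 0 at the second.

  Only the underlying sets enter, and the underlying set of a colimit does not depend on the
  diffeologies.  The colimit lemmas are therefore applied to the diagram in which every affine
  simplex carries the coarse diffeology, where all maps are smooth.
\<close>


section \<open>The underlying set of a realization\<close>

text \<open>The coarse diffeology on the underlying set of \<open>X\<close>: all functions on open sets are plots.\<close>

definition coarse :: "'a diff_space \<Rightarrow> 'a diff_space" where
  "coarse X = \<lparr>points = points X,
     plot = (\<lambda>n U p. openin (Euclidean_space n) U \<and> p \<in> U \<rightarrow> points X)\<rparr>"

lemma points_coarse [simp]: "points (coarse X) = points X"
  by (simp add: coarse_def)

lemma diffeological_space_coarse: "diffeological_space (coarse X)"
proof
  fix n \<V> p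
  assume *: "\<And>V. V \<in> \<V> \<Longrightarrow> openin (Euclidean_space n) V \<and> plot (coarse X) n V p"
  have "openin (Euclidean_space n) (\<Union>\<V>)"
    by (rule openin_Union) (use * in blast)
  then show "plot (coarse X) n (\<Union>\<V>) p"
    using * by (fastforce simp: coarse_def)
qed (auto simp: coarse_def smooth_map_def Pi_iff)

lemma smooth_between_coarse:
  "f \<in> points X \<rightarrow> points Y \<Longrightarrow> smooth_between (coarse X) (coarse Y) f"
  by (auto simp: smooth_between_def coarse_def)

lemma points_affine_simplex:
  "points (affine_simplex n) = {x \<in> topspace (Euclidean_space (Suc n)). (\<Sum>i\<le>n. x i) = 1}"
  by (simp add: affine_simplex_def diff_sub_def)

text \<open>With the singletons for \<open>P\<close> this is the definition of the push-forward; the case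
  \<open>P = (\<lambda>_. True)\<close> is the preservation of the total sum.\<close>

lemma sum_affine_push:
  assumes "f \<in> {..n} \<rightarrow> {..m}"
  shows "(\<Sum>l\<in>{l. l \<le> m \<and> P l}. affine_push n f x l) = (\<Sum>i\<in>{i. i \<le> n \<and> P (f i)}. x i)"
proof -
  have "(\<Sum>l\<in>{l. l \<le> m \<and> P l}. affine_push n f x l)
      = (\<Sum>l\<in>{l. l \<le> m \<and> P l}. \<Sum>i\<in>{i \<in> {i. i \<le> n \<and> P (f i)}. f i = l}. x i)"
    unfolding affine_push_def by (intro sum.cong) auto
  also have "\<dots> = (\<Sum>i\<in>{i. i \<le> n \<and> P (f i)}. x i)"
    by (rule sum.group) (use assms in auto)
  finally show ?thesis .
qed

lemma affine_push_maps:
  assumes f: "f \<in> simplex_hom n m" and x: "x \<in> points (affine_simplex n)"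
  shows "affine_push n f x \<in> points (affine_simplex m)"
proof -
  have f': "f \<in> {..n} \<rightarrow> {..m}"
    using f by (auto simp: simplex_hom_def)
  have "affine_push n f x l = 0" if "Suc m \<le> l" for l
    unfolding affine_push_def using f' that by (intro sum.neutral) force
  moreover have "(\<Sum>l\<le>m. affine_push n f x l) = 1"
    using sum_affine_push[OF f', where P = "\<lambda>_. True" and x = x] x
    by (simp add: points_affine_simplex atMost_def)
  ultimately show ?thesis
    by (simp add: points_affine_simplex topspace_Euclidean_space)
qed

lemma colim_inj_coarse:
  "colim_inj J (coarse \<circ> D) M = colim_inj J D M"
  by (simp add: colim_inj_def colim_rel_def colim_gen_def fun_eq_iff)

lemma points_colim_coarse: "points (diff_colim J (coarse \<circ> D) M) = points (diff_colim J D M)"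
  by (simp add: diff_colim_def colim_rel_def colim_gen_def)

context simplicial_set
begin

lemma diff_diagram_coarse:
  "diff_diagram (simplex_objects X) (coarse \<circ> (affine_simplex \<circ> fst)) (simplex_arrows X)"
proof (rule diff_diagram.intro)
  fix j k h
  assume "(j, k, h) \<in> simplex_arrows X"
  then obtain n m f b where *: "j = (n, act X n m f b)" "k = (m, b)" "h = affine_push n f"
      "f \<in> simplex_hom n m" "b \<in> simplices X m"
    by (auto simp: simplex_arrows_def)
  have "smooth_between (coarse (affine_simplex n)) (coarse (affine_simplex m)) h"
    using affine_push_maps[OF *(4)] *(3) by (intro smooth_between_coarse) auto
  then show "j \<in> simplex_objects X \<and> k \<in> simplex_objects X \<and>
      smooth_between ((coarse \<circ> (affine_simplex \<circ> fst)) j) ((coarse \<circ> (affine_simplex \<circ> fst)) k) h"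
    using * act_maps by (simp add: simplex_objects_def)
qed (simp add: diffeological_space_coarse)

lemma realization_inj_maps:
  assumes "a \<in> simplices X n" "x \<in> points (affine_simplex n)"
  shows "realization_inj X (n, a) x \<in> points (realization X)"
  using diff_diagram.colim_inj_maps[OF diff_diagram_coarse, of "(n, a)" x] assms
  by (simp add: realization_inj_def realization_def simplex_objects_def
      colim_inj_coarse points_colim_coarse)

lemma realization_inj_push:
  assumes "f \<in> simplex_hom n m" "b \<in> simplices X m" "x \<in> points (affine_simplex n)"
  shows "realization_inj X (m, b) (affine_push n f x) = realization_inj X (n, act X n m f b) x"
proof -
  have "((n, act X n m f b), (m, b), affine_push n f) \<in> simplex_arrows X"
    using assms by (auto simp: simplex_arrows_def)
  then show ?thesis
    using diff_diagram.colim_inj_arrow[OF diff_diagram_coarse] assms(3)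
    by (simp add: realization_inj_def colim_inj_coarse)
qed

lemma colim_desc_realization_inj:
  assumes compat: "\<And>n m f b x. f \<in> simplex_hom n m \<Longrightarrow> b \<in> simplices X m \<Longrightarrow>
      x \<in> points (affine_simplex n) \<Longrightarrow> g (m, b) (affine_push n f x) = g (n, act X n m f b) x"
    and "a \<in> simplices X n" "x \<in> points (affine_simplex n)"
  shows "colim_desc g (realization_inj X (n, a) x) = g (n, a) x"
proof -
  have "colim_desc g (colim_inj (simplex_objects X) (coarse \<circ> (affine_simplex \<circ> fst))
      (simplex_arrows X) (n, a) x) = g (n, a) x"
    using assms(2,3) by (intro diff_diagram.colim_desc_inj[OF diff_diagram_coarse])
      (auto simp: simplex_arrows_def simplex_objects_def compat)
  then show ?thesis
    by (simp add: realization_inj_def colim_inj_coarse)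
qed

lemma realization_map_inj:
  assumes "simplicial_set B"
    and h: "\<And>n a. a \<in> simplices X n \<Longrightarrow> h n a \<in> simplices B n"
    and nat: "\<And>n m f b. f \<in> simplex_hom n m \<Longrightarrow> b \<in> simplices X m \<Longrightarrow>
      h n (act X n m f b) = act B n m f (h m b)"
    and a: "a \<in> simplices X n" and x: "x \<in> points (affine_simplex n)"
  shows "realization_map B h (realization_inj X (n, a) x) = realization_inj B (n, h n a) x"
proof -
  interpret B: simplicial_set B by fact
  show ?thesis
    unfolding realization_map_def
    by (subst colim_desc_realization_inj) (use a x in \<open>simp_all add: nat h B.realization_inj_push\<close>)
qed

end

lemma simplicial_set_prod:
  assumes "simplicial_set X" "simplicial_set Y"
  shows "simplicial_set (sset_prod X Y)"
proof -
  interpret X: simplicial_set X by fact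
  interpret Y: simplicial_set Y by fact
  show ?thesis
    by unfold_locales
      (auto simp: sset_prod_def X.act_maps Y.act_maps X.act_id Y.act_id X.act_comp Y.act_comp)
qed

lemma realization_comparison_inj:
  assumes X: "simplicial_set X" and Y: "simplicial_set Y"
    and "a \<in> simplices X n" "b \<in> simplices Y n" "x \<in> points (affine_simplex n)"
  shows "realization_comparison X Y (realization_inj (sset_prod X Y) (n, a, b) x) =
    (realization_inj X (n, a) x, realization_inj Y (n, b) x)"
proof -
  interpret P: simplicial_set "sset_prod X Y"
    using X Y by (rule simplicial_set_prod)
  show ?thesis
    unfolding realization_comparison_def using assms
    by (subst (1 2) P.realization_map_inj) (auto simp: sset_prod_def)
qed


section \<open>Standard simplices\<close>

text \<open>All simplices of the standard \<open>k\<close>-simplex.\<close>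

definition simplex_maps :: "nat \<Rightarrow> (nat \<Rightarrow> nat) set" where
  "simplex_maps k = (\<Union>n. simplex_hom n k)"

text \<open>The standard \<open>k\<close>-simplex, with the map \<open>a : [n] \<rightarrow> [k]\<close> represented by \<open>e a\<close>.  The encoding \<open>e\<close>,
  required to be injective on all simplices, allows the simplices to be of any infinite type.\<close>

definition standard_simplex :: "((nat \<Rightarrow> nat) \<Rightarrow> 'a) \<Rightarrow> nat \<Rightarrow> 'a sset" where
  "standard_simplex e k = \<lparr>simplices = (\<lambda>n. e ` simplex_hom n k),
     act = (\<lambda>n m f x. e (compose {..n} (inv_into (simplex_maps k) e x) f))\<rparr>"

lemma ex_inj_on_simplex_maps:
  assumes "infinite (UNIV :: 'a set)"
  shows "\<exists>e :: (nat \<Rightarrow> nat) \<Rightarrow> 'a. inj_on e (simplex_maps k)"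
proof -
  have "finite (simplex_hom n k)" for n
    by (rule finite_subset[OF _ finite_PiE[of "{..n}" "\<lambda>_. {..k}"]]) (auto simp: simplex_hom_def)
  then have "countable (simplex_maps k)"
    by (auto simp: simplex_maps_def intro: countable_finite)
  then obtain c :: "(nat \<Rightarrow> nat) \<Rightarrow> nat" where "inj_on c (simplex_maps k)"
    by (auto simp: countable_def)
  moreover obtain d :: "nat \<Rightarrow> 'a" where "inj d"
    using infinite_countable_subset[OF assms] by auto
  ultimately have "inj_on (d \<circ> c) (simplex_maps k)"
    by (auto intro: comp_inj_on inj_on_subset)
  then show ?thesis by blast
qed

lemma compose_simplex_hom:
  assumes "f \<in> simplex_hom n m" "g \<in> simplex_hom m l"
  shows "compose {..n} g f \<in> simplex_hom n l"
  using assms by (fastforce simp: simplex_hom_def compose_def monotone_on_def PiE_iff)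

lemma decode_simplex:
  assumes "inj_on e (simplex_maps k)" "a \<in> simplex_hom n k"
  shows "inv_into (simplex_maps k) e (e a) = a"
  using assms by (auto simp: simplex_maps_def intro!: inv_into_f_f)

lemma act_standard_simplex:
  assumes "inj_on e (simplex_maps k)" "a \<in> simplex_hom m k"
  shows "act (standard_simplex e k) n m f (e a) = e (compose {..n} a f)"
  using decode_simplex[OF assms] by (simp add: standard_simplex_def)

lemma simplices_standard_simplex: "simplices (standard_simplex e k) n = e ` simplex_hom n k"
  by (simp add: standard_simplex_def)

lemma simplicial_set_standard_simplex:
  assumes e: "inj_on e (simplex_maps k)"
  shows "simplicial_set (standard_simplex e k)"
proof
  fix f n m x
  assume "f \<in> simplex_hom n m" "x \<in> simplices (standard_simplex e k) m"
  then show "act (standard_simplex e k) n m f x \<in> simplices (standard_simplex e k) n"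
    by (auto simp: simplices_standard_simplex act_standard_simplex[OF e] compose_simplex_hom)
next
  fix x n
  assume "x \<in> simplices (standard_simplex e k) n"
  then obtain a where a: "a \<in> simplex_hom n k" "x = e a"
    by (auto simp: simplices_standard_simplex)
  then have "compose {..n} a (restrict id {..n}) = a"
    by (auto simp: compose_def simplex_hom_def fun_eq_iff PiE_iff extensional_def)
  then show "act (standard_simplex e k) n n (restrict id {..n}) x = x"
    using a by (simp add: act_standard_simplex[OF e])
next
  fix f n m g l x
  assume f: "f \<in> simplex_hom n m" and g: "g \<in> simplex_hom m l"
    and "x \<in> simplices (standard_simplex e k) l"
  then obtain a where a: "a \<in> simplex_hom l k" "x = e a"
    by (auto simp: simplices_standard_simplex)
  have "compose {..n} a (compose {..n} g f) = compose {..n} (compose {..m} a g) f"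
    using f by (auto simp: compose_def simplex_hom_def fun_eq_iff)
  then show "act (standard_simplex e k) n l (compose {..n} g f) x =
      act (standard_simplex e k) n m f (act (standard_simplex e k) m l g x)"
    using a g by (simp add: act_standard_simplex[OF e] compose_simplex_hom)
qed

text \<open>In \<open>|\<Delta>\<^sup>k|\<^sub>D\<close> every point is equal to one of the top simplex \<open>id : [k] \<rightarrow> [k]\<close>.\<close>

lemma realization_inj_standard_simplex:
  assumes e: "inj_on e (simplex_maps k)"
    and a: "a \<in> simplex_hom n k" and x: "x \<in> points (affine_simplex n)"
  shows "realization_inj (standard_simplex e k) (n, e a) x =
    realization_inj (standard_simplex e k) (k, e (restrict id {..k})) (affine_push n a x)"
proof -
  interpret simplicial_set "standard_simplex e k"
    using e by (rule simplicial_set_standard_simplex)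
  have id: "restrict id {..k} \<in> simplex_hom k k"
    by (auto simp: simplex_hom_def monotone_on_def)
  have "compose {..n} (restrict id {..k}) a = a"
    using a by (fastforce simp: compose_def simplex_hom_def fun_eq_iff PiE_iff extensional_def)
  then show ?thesis
    using realization_inj_push[OF a _ x, of "e (restrict id {..k})"] id
    by (simp add: act_standard_simplex[OF e] simplices_standard_simplex)
qed

text \<open>The total barycentric coordinate at a vertex \<open>(p, q)\<close> is a function on \<open>|\<Delta>\<^sup>k \<times> \<Delta>\<^sup>l|\<^sub>D\<close>.\<close>

lemma vertex_weight_eq:
  fixes p q :: nat
  assumes d: "inj_on d (simplex_maps k)" and e: "inj_on e (simplex_maps l)"
    and ab: "a \<in> simplex_hom n k" "b \<in> simplex_hom n l" "x \<in> points (affine_simplex n)"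
    and ab': "a' \<in> simplex_hom n' k" "b' \<in> simplex_hom n' l" "x' \<in> points (affine_simplex n')"
    and eq: "realization_inj (sset_prod (standard_simplex d k) (standard_simplex e l)) (n, d a, e b) x =
      realization_inj (sset_prod (standard_simplex d k) (standard_simplex e l)) (n', d a', e b') x'"
  shows "(\<Sum>i\<in>{i. i \<le> n \<and> a i = p \<and> b i = q}. x i) = (\<Sum>i\<in>{i. i \<le> n' \<and> a' i = p \<and> b' i = q}. x' i)"
proof -
  let ?P = "sset_prod (standard_simplex d k) (standard_simplex e l)"
  interpret P: simplicial_set ?P
    using d e by (intro simplicial_set_prod simplicial_set_standard_simplex)
  define w :: "nat \<times> 'a \<times> 'b \<Rightarrow> (nat \<Rightarrow> real) \<Rightarrow> real" where
    "w = (\<lambda>(n, s, t) x. \<Sum>i\<in>{i. i \<le> n \<and> inv_into (simplex_maps k) d s i = p \<and>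
        inv_into (simplex_maps l) e t i = q}. x i)"
  have w: "w (n, d a, e b) x = (\<Sum>i\<in>{i. i \<le> n \<and> a i = p \<and> b i = q}. x i)"
    if "a \<in> simplex_hom n k" "b \<in> simplex_hom n l" for n a b x
    using that by (simp add: w_def decode_simplex[OF d] decode_simplex[OF e])
  have simplices: "simplices ?P n = d ` simplex_hom n k \<times> e ` simplex_hom n l" for n
    by (simp add: sset_prod_def standard_simplex_def)
  have compat: "w (m, s) (affine_push n f x) = w (n, act ?P n m f s) x"
    if f: "f \<in> simplex_hom n m" and s: "s \<in> simplices ?P m" for n m f s x
  proof -
    obtain a b where ab: "a \<in> simplex_hom m k" "b \<in> simplex_hom m l" "s = (d a, e b)"
      using s by (auto simp: simplices)
    have "f \<in> {..n} \<rightarrow> {..m}"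
      using f by (auto simp: simplex_hom_def)
    then have "w (m, s) (affine_push n f x) = (\<Sum>i\<in>{i. i \<le> n \<and> a (f i) = p \<and> b (f i) = q}. x i)"
      using ab by (simp add: w sum_affine_push)
    also have "\<dots> = (\<Sum>i\<in>{i. i \<le> n \<and> compose {..n} a f i = p \<and> compose {..n} b f i = q}. x i)"
      by (intro sum.cong) (auto simp: compose_def)
    also have "\<dots> = w (n, d (compose {..n} a f), e (compose {..n} b f)) x"
      using f ab by (simp add: w compose_simplex_hom)
    also have "(d (compose {..n} a f), e (compose {..n} b f)) = act ?P n m f s"
      using ab by (simp add: sset_prod_def act_standard_simplex[OF d] act_standard_simplex[OF e])
    finally show ?thesis .
  qed
  have "w (n, d a, e b) x = w (n', d a', e b') x'"
    using P.colim_desc_realization_inj[where g = w and a = "(d a, e b)" and n = n and x = x]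
      P.colim_desc_realization_inj[where g = w and a = "(d a', e b')" and n = n' and x = x'] compat ab ab' eq
    by (simp add: simplices)
  then show ?thesis
    using ab ab' by (simp add: w)
qed


section \<open>The square\<close>

theorem proposition4p13:
  assumes "infinite (UNIV :: 'a set)"
  shows "\<not> (\<forall>(X :: 'a sset) (Y :: 'a sset). simplicial_set X \<longrightarrow> simplicial_set Y \<longrightarrow>
    diffeomorphism (realization (sset_prod X Y)) (diff_prod (realization X) (realization Y))
      (realization_comparison X Y))"
proof
  assume *: "\<forall>(X :: 'a sset) (Y :: 'a sset). simplicial_set X \<longrightarrow> simplicial_set Y \<longrightarrow>
    diffeomorphism (realization (sset_prod X Y)) (diff_prod (realization X) (realization Y))
      (realization_comparison X Y)"
  obtain e :: "(nat \<Rightarrow> nat) \<Rightarrow> 'a" where e: "inj_on e (simplex_maps 1)"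
    using ex_inj_on_simplex_maps[OF assms] by blast
  define X where "X = standard_simplex e 1"
  have X: "simplicial_set X"
    unfolding X_def using e by (rule simplicial_set_standard_simplex)
  interpret P: simplicial_set "sset_prod X X"
    using X X by (rule simplicial_set_prod)
  \<comment> \<open>The two surjections \<open>[2] \<rightarrow> [1]\<close>: the chain \<open>\<sigma>\<close> is \<open>(a, b)\<close> and the chain \<open>\<tau>\<close> is \<open>(b, a)\<close>.\<close>
  define a b :: "nat \<Rightarrow> nat"
    where "a = (\<lambda>i\<in>{..2}. if i = 2 then 1 else 0)" and "b = (\<lambda>i\<in>{..2}. if i = 0 then 0 else 1)"
  define x y :: "nat \<Rightarrow> real"
    where "x = (\<lambda>i. if i = 1 then 1 else 0)"
      and "y = (\<lambda>i. if i = 0 then 1 else if i = 1 then -1 else if i = 2 then 1 else 0)"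
  have ab: "a \<in> simplex_hom 2 1" "b \<in> simplex_hom 2 1"
    by (simp_all add: simplex_hom_def a_def b_def monotone_on_def)
  have sum2: "(\<Sum>i\<le>2. z i) = z 0 + z 1 + z 2" for z :: "nat \<Rightarrow> real"
    by (simp add: numeral_2_eq_2)
  have sums: "(\<Sum>i\<in>{i. i \<le> 2 \<and> Q i}. z i) =
      (if Q 0 then z 0 else 0) + (if Q 1 then z 1 else 0) + (if Q 2 then z 2 else 0)"
    for Q and z :: "nat \<Rightarrow> real"
    using sum.inter_filter[of "{..2}" z Q] by (simp add: sum2)
  have xy: "x \<in> points (affine_simplex 2)" "y \<in> points (affine_simplex 2)"
    by (simp_all add: points_affine_simplex topspace_Euclidean_space sum2 x_def y_def)
  \<comment> \<open>The common images in \<open>\<bbbA>\<^sup>1 \<times> \<bbbA>\<^sup>1\<close>: the point \<open>(1, 0)\<close> in the first and \<open>(0, 1)\<close> in the second factor.\<close>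
  have push: "affine_push 2 a x = affine_push 2 b y" "affine_push 2 b x = affine_push 2 a y"
    unfolding affine_push_def fun_eq_iff sums by (simp_all add: a_def b_def x_def y_def)
  have simplices: "e a \<in> simplices X 2" "e b \<in> simplices X 2"
    using ab by (auto simp: X_def simplices_standard_simplex)
  let ?u = "realization_inj (sset_prod X X) (2, e a, e b) x"
  let ?v = "realization_inj (sset_prod X X) (2, e b, e a) y"
  have uv: "?u \<in> points (realization (sset_prod X X))" "?v \<in> points (realization (sset_prod X X))"
    by (rule P.realization_inj_maps; use simplices xy in \<open>simp add: sset_prod_def\<close>)+
  note top = realization_inj_standard_simplex[OF e, folded X_def]
  have "realization_inj X (2, e a) x = realization_inj X (2, e b) y"
       "realization_inj X (2, e b) x = realization_inj X (2, e a) y"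
    unfolding top[OF ab(1) xy(1)] top[OF ab(2) xy(1)] top[OF ab(1) xy(2)] top[OF ab(2) xy(2)] push
    by (rule refl)+
  then have "realization_comparison X X ?u = realization_comparison X X ?v"
    using simplices xy by (simp add: realization_comparison_inj[OF X X])
  moreover have "diffeomorphism (realization (sset_prod X X))
      (diff_prod (realization X) (realization X)) (realization_comparison X X)"
    using * X by simp
  then obtain g where
    "\<forall>c\<in>points (realization (sset_prod X X)). g (realization_comparison X X c) = c"
    unfolding diffeomorphism_def by blast
  ultimately have "?u = ?v"
    using uv by metis
  \<comment> \<open>The weights of the two points at the vertex \<open>01\<close> are 1 and 0.\<close>
  from vertex_weight_eq[OF e e ab xy(1) ab(2,1) xy(2) this[unfolded X_def], of 0 1]
  show False
    unfolding sums by (simp add: a_def b_def x_def y_def)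
qed

end
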